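(* Assume condition (F), and let $\phi$ be a positive bounded solution of (TW) (so $u(x,t)=\phi(x+ct)$ solves (RD)) with $\liminf_{s\to-\infty}\phi(s)=0$. Then $\lim_{s\to-\infty}\phi(s)=0$, the critical speed $c_*^+$ is finite, and $c\geq c_*^+$. Similarly, if $\liminf_{s\to+\infty}\phi(s)=0$, then $\lim_{s\to+\infty}\phi(s)=0$, $c_*^-$ is finite, and $c\leq c_*^-$. Hence (TW) has neither positive bounded solutions vanishing at both $\pm\infty$ (pulses) nor semi-wavefronts for any $c\in(c_*^-,c_*^+)$.
   Context: Let $h\geq0$, $c\in\mathbb{R}$. Let $K:\mathbb{R}\to[0,\infty)$ be integrable with $\int_{\mathbb{R}}K(s)ds=1$. Condition (F): $f,g:[0,\infty)\to[0,\infty)$; $f$ locally Lipschitz and strictly increasing, $f(0)=g(0)=0$, $f'(0)>0$, $f(+\infty)>\sup_{s\geq0}g(s)$; $g$ continuous, $g(t)>0$ for $t>0$, and $f'(0)<g'(0)<+\infty$. (RD): $u_t(t,x)=u_{xx}(t,x)-f(u(t,x))+\int_{\mathbb{R}}K(x-y)g(u(t-h,y))dy$. (TW): $y''(t)-cy'(t)-f(y(t))+\int_{\mathbb{R}}K(s)g(y(t-s-ch))ds=0$, $t\in\mathbb{R}$; solutions are $C^2$. A semi-wavefront is a positive bounded solution of (TW) with $\phi(-\infty)=0$ or $\phi(+\infty)=0$. $\chi_1(z,c)=z^2-cz-f'(0)+g'(0)e^{-zch}\int_{\mathbb{R}}K(s)e^{-zs}ds$ for real $z$ where the integral converges. $c_*^+=\inf\{c:\chi_1(z,c)=0$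 for some $z>0$ in the domain$\}$ ($+\infty$ if empty), $c_*^-=\sup\{c:\chi_1(z,c)=0$ for some $z<0$ in the domain$\}$ ($-\infty$ if empty). *)

theory Defs
  imports "HOL-Analysis.Analysis" "HOL-Library.Extended_Real"
begin

definition condF :: "(real \<Rightarrow> real) \<Rightarrow> (real \<Rightarrow> real) \<Rightarrow> real \<Rightarrow> real \<Rightarrow> bool" where
  "condF f g f0 g0 \<longleftrightarrow>
     (\<forall>t\<ge>0. f t \<ge> 0 \<and> g t \<ge> 0) \<and>
     (\<forall>T. \<exists>L. lipschitz_on L {0..T} f) \<and>
     strict_mono_on {0..} f \<and>
     f 0 = 0 \<and> g 0 = 0 \<and>
     (f has_real_derivative f0) (at 0 within {0..}) \<and> f0 > 0 \<and>
     (\<exists>L::ereal. ((\<lambda>t. ereal (f t)) \<longlongrightarrow> L) at_top \<and>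
        (SUP s\<in>{0..}. ereal (g s)) < L) \<and>
     continuous_on {0..} g \<and> (\<forall>t>0. g t > 0) \<and>
     (g has_real_derivative g0) (at 0 within {0..}) \<and> f0 < g0"

definition conv_kernel :: "(real \<Rightarrow> real) \<Rightarrow> bool" where
  "conv_kernel K \<longleftrightarrow> (\<forall>s. K s \<ge> 0) \<and> integrable lborel K \<and> (LINT s|lborel. K s) = 1"

definition tw_solution ::
  "(real \<Rightarrow> real) \<Rightarrow> (real \<Rightarrow> real) \<Rightarrow> (real \<Rightarrow> real) \<Rightarrow> real \<Rightarrow> real \<Rightarrow> (real \<Rightarrow> real) \<Rightarrow> bool" where
  "tw_solution K f g h c \<phi> \<longleftrightarrow>
     (\<exists>\<phi>1 \<phi>2. (\<forall>t. (\<phi> has_real_derivative \<phi>1 t) (at t) \<and> (\<phi>1 has_real_derivative \<phi>2 t) (at t)) \<and>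
        continuous_on UNIV \<phi>2 \<and>
        (\<forall>t. \<phi>2 t - c * \<phi>1 t - f (\<phi> t) + (LINT s|lborel. K s * g (\<phi> (t - s - c * h))) = 0))"

definition pos_bdd_solution ::
  "(real \<Rightarrow> real) \<Rightarrow> (real \<Rightarrow> real) \<Rightarrow> (real \<Rightarrow> real) \<Rightarrow> real \<Rightarrow> real \<Rightarrow> (real \<Rightarrow> real) \<Rightarrow> bool" where
  "pos_bdd_solution K f g h c \<phi> \<longleftrightarrow> tw_solution K f g h c \<phi> \<and> (\<forall>t. \<phi> t > 0) \<and> bounded (range \<phi>)"

definition semi_wavefront ::
  "(real \<Rightarrow> real) \<Rightarrow> (real \<Rightarrow> real) \<Rightarrow> (real \<Rightarrow> real) \<Rightarrow> real \<Rightarrow> real \<Rightarrow> (real \<Rightarrow> real) \<Rightarrow> bool" where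
  "semi_wavefront K f g h c \<phi> \<longleftrightarrow> pos_bdd_solution K f g h c \<phi> \<and>
     ((\<phi> \<longlongrightarrow> 0) at_bot \<or> (\<phi> \<longlongrightarrow> 0) at_top)"

text \<open>chi_1(z,c); only meaningful where the integral converges (checked separately).\<close>
definition chi1 :: "(real \<Rightarrow> real) \<Rightarrow> real \<Rightarrow> real \<Rightarrow> real \<Rightarrow> real \<Rightarrow> real \<Rightarrow> real" where
  "chi1 K f0 g0 h z c = z^2 - c * z - f0 + g0 * exp (- z * c * h) * (LINT s|lborel. K s * exp (- z * s))"

definition chi_dom :: "(real \<Rightarrow> real) \<Rightarrow> real set" where
  "chi_dom K = {z. integrable lborel (\<lambda>s. K s * exp (- z * s))}"

definition cstar_plus :: "(real \<Rightarrow> real) \<Rightarrow> real \<Rightarrow> real \<Rightarrow> real \<Rightarrow> ereal" where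
  "cstar_plus K f0 g0 h = Inf {ereal c | c. \<exists>z. z > 0 \<and> z \<in> chi_dom K \<and> chi1 K f0 g0 h z c = 0}"

definition cstar_minus :: "(real \<Rightarrow> real) \<Rightarrow> real \<Rightarrow> real \<Rightarrow> real \<Rightarrow> ereal" where
  "cstar_minus K f0 g0 h = Sup {ereal c | c. \<exists>z. z < 0 \<and> z \<in> chi_dom K \<and> chi1 K f0 g0 h z c = 0}"

end

theory Submission
  imports Defs
begin

text \<open>
  Since \<open>\<phi>\<close> is a positive supersolution of a linear equation, \<open>\<bar>\<phi>'\<bar> \<le> \<kappa> \<phi>\<close> (Harnack). Minimising
  \<open>\<phi>(t) exp (\<rho> (t - t0)\<^sup>2)\<close> gives a point where a Gaussian-damped exponential of some slope \<open>z\<close>,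
  \<open>\<bar>z\<bar> \<le> \<kappa>\<close>, touches \<open>\<phi>\<close> from below; inserting it into the equation and letting
  \<open>\<phi>(t0) \<rightarrow> 0\<close> and \<open>\<rho> \<rightarrow> 0\<close> yields \<open>\<chi>\<^sub>1(z, c) \<le> 0\<close> in the limit. If \<open>\<phi> \<ge> \<phi>(t0)\<close> on a long
  interval to the right (left) of \<open>t0\<close>, then \<open>z \<ge> 0\<close> (\<open>z \<le> 0\<close>). As \<open>\<chi>\<^sub>1(\<cdot>, c)\<close> is convex and
  positive at 0, both signs cannot occur for the same \<open>c\<close>. This excludes oscillation at \<open>-\<infinity>\<close> as well
  as pulses, and a zero of \<open>\<chi>\<^sub>1\<close> with positive exponent bounds the critical speed by \<open>c\<close>.
\<close>

section \<open>Logarithmic derivative bounds for positive supersolutions\<close>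

text \<open>The operator factors as (D - m)(D - l), so \<open>v = \<phi>1 - l * \<phi>\<close>
  satisfies v' <= m v. Once negative, \<open>v\<close> stays below that negative value; then
  \<open>\<phi>\<close> falls at least linearly and cannot remain positive.\<close>

lemma supersolution_deriv_lower:
  fixes \<phi> \<phi>1 \<phi>2 :: "real \<Rightarrow> real"
  assumes d1: "\<And>t. (\<phi> has_real_derivative \<phi>1 t) (at t)"
    and d2: "\<And>t. (\<phi>1 has_real_derivative \<phi>2 t) (at t)"
    and pos: "\<And>t. \<phi> t > 0"
    and super: "\<And>t. \<phi>2 t \<le> (l + m) * \<phi>1 t - l * m * \<phi> t"
    and "l < 0" "0 < m"
  shows "l * \<phi> t \<le> \<phi>1 t"
proof (rule ccontr)
  define v where "v = (\<lambda>t. \<phi>1 t - l * \<phi> t)"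
  assume "\<not> l * \<phi> t \<le> \<phi>1 t"
  hence neg: "v t < 0" by (simp add: v_def)
  have dv: "(v has_real_derivative \<phi>2 s - l * \<phi>1 s) (at s)" for s
    unfolding v_def by (auto intro!: derivative_eq_intros d1 d2)
  have v_le: "v s \<le> v t" if "t \<le> s" for s
  proof -
    have "v s * exp (- m * s) \<le> v t * exp (- m * t)"
    proof (rule DERIV_nonpos_imp_nonincreasing[OF that])
      fix x
      have "((\<lambda>s. v s * exp (- m * s)) has_real_derivative
          (\<phi>2 x - l * \<phi>1 x - m * v x) * exp (- m * x)) (at x)"
        by (auto intro!: derivative_eq_intros dv simp: algebra_simps)
      moreover have "\<phi>2 x - l * \<phi>1 x - m * v x \<le> 0"
        using super[of x] by (simp add: v_def algebra_simps)
      ultimately show "\<exists>y. ((\<lambda>s. v s * exp (- m * s)) has_real_derivative y) (at x) \<and> y \<le> 0"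
        by (meson exp_ge_zero mult_nonpos_nonneg)
    qed
    hence "v s * exp (- m * s) * exp (m * s) \<le> v t * exp (- m * t) * exp (m * s)"
      by (rule mult_right_mono) simp
    hence "v s \<le> v t * exp (m * (s - t))"
      by (simp add: mult.assoc flip: exp_add) (simp add: algebra_simps)
    moreover have "v t * exp (m * (s - t)) \<le> v t * 1"
      using neg \<open>0 < m\<close> that by (intro mult_left_mono_neg) auto
    ultimately show ?thesis by simp
  qed
  \<comment> \<open>The line of slope \<open>v t\<close> through the point of the graph at
    \<open>t\<close> vanishes at \<open>s\<close>.\<close>
  define s where "s = t - \<phi> t / v t"
  have "t \<le> s" using divide_pos_neg[OF pos[of t] neg] by (simp add: s_def)
  have "\<phi> s - v t * s \<le> \<phi> t - v t * t"
  proof (rule DERIV_nonpos_imp_nonincreasing[OF \<open>t \<le> s\<close>])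
    fix x assume "t \<le> x"
    have "((\<lambda>s. \<phi> s - v t * s) has_real_derivative \<phi>1 x - v t) (at x)"
      by (auto intro!: derivative_eq_intros d1)
    moreover have "\<phi>1 x - v t \<le> 0"
      using v_le[OF \<open>t \<le> x\<close>] mult_neg_pos[OF \<open>l < 0\<close> pos[of x]] by (simp add: v_def)
    ultimately show "\<exists>y. ((\<lambda>s. \<phi> s - v t * s) has_real_derivative y) (at x) \<and> y \<le> 0"
      by blast
  qed
  moreover have "v t * s = v t * t - \<phi> t"
    using neg by (simp add: s_def right_diff_distrib)
  ultimately have "\<phi> s \<le> 0" by simp
  with pos[of s] show False by simp
qed

text \<open>With \<open>l < 0 < m\<close> the roots of x^2 - c x - L, the preceding bound gives
  \<open>l * \<phi> t \<le> \<phi>1 t\<close>; applied to the mirrored function it gives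
  \<open>\<phi>1 t \<le> m * \<phi> t\<close>.\<close>

lemma supersolution_deriv_bound:
  fixes \<phi> \<phi>1 \<phi>2 :: "real \<Rightarrow> real"
  assumes d1: "\<And>t. (\<phi> has_real_derivative \<phi>1 t) (at t)"
    and d2: "\<And>t. (\<phi>1 has_real_derivative \<phi>2 t) (at t)"
    and pos: "\<And>t. \<phi> t > 0"
    and super: "\<And>t. \<phi>2 t - c * \<phi>1 t - L * \<phi> t \<le> 0"
    and "L > 0"
  obtains \<kappa> where "\<kappa> > 0" "\<And>t. \<bar>\<phi>1 t\<bar> \<le> \<kappa> * \<phi> t"
proof -
  define r where "r = sqrt (c\<^sup>2 + 4 * L)"
  define l where "l = (c - r) / 2"
  define m where "m = (c + r) / 2"
  have r2: "r * r = c\<^sup>2 + 4 * L"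
    using \<open>L > 0\<close> by (simp add: r_def)
  have "\<bar>c\<bar> < r"
    unfolding r_def using \<open>L > 0\<close> by (intro real_less_rsqrt) simp
  hence lm: "l < 0" "0 < m" by (auto simp: l_def m_def)
  have sum: "l + m = c" by (simp add: l_def m_def field_simps)
  have prod: "l * m = - L"
    using r2 by (simp add: l_def m_def field_simps power2_eq_square)
  have low: "l * \<phi> t \<le> \<phi>1 t" for t
    by (rule supersolution_deriv_lower[where m = m, OF d1 d2 pos _ lm])
       (use super in \<open>simp add: sum prod algebra_simps\<close>)
  \<comment> \<open>Mirroring flips the sign of the first derivative, so the roots become
    \<open>- m\<close> and \<open>- l\<close>.\<close>
  have "- m * \<phi> (- (- t)) \<le> - \<phi>1 (- (- t))" for t
  proof (rule supersolution_deriv_lower[where \<phi> = "\<lambda>t. \<phi> (- t)" and ?\<phi>1.0 = "\<lambda>t. - \<phi>1 (- t)"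
        and ?\<phi>2.0 = "\<lambda>t. \<phi>2 (- t)" and m = "- l" and t = "- t"])
    fix t
    show "((\<lambda>t. \<phi> (- t)) has_real_derivative - \<phi>1 (- t)) (at t)"
      using d1[of "- t"] DERIV_mirror[of \<phi> "\<phi>1 (- t)" t] by simp
    show "((\<lambda>t. - \<phi>1 (- t)) has_real_derivative \<phi>2 (- t)) (at t)"
      using DERIV_minus[of "\<lambda>t. \<phi>1 (- t)" "- \<phi>2 (- t)" t] d2[of "- t"] DERIV_mirror[of \<phi>1 "\<phi>2 (- t)" t]
      by simp
    have "(- m + - l) * - \<phi>1 (- t) - - m * - l * \<phi> (- t)
        = (l + m) * \<phi>1 (- t) - l * m * \<phi> (- t)"
      by (simp add: algebra_simps)
    also have "\<dots> = c * \<phi>1 (- t) + L * \<phi> (- t)"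
      by (simp only: sum prod)
    finally show "\<phi>2 (- t) \<le> (- m + - l) * - \<phi>1 (- t) - - m * - l * \<phi> (- t)"
      using super[of "- t"] by simp
  qed (use lm pos in auto)
  hence up: "\<phi>1 t \<le> m * \<phi> t" for t by simp
  show thesis
  proof (rule that[of "m - l"])
    show "\<bar>\<phi>1 t\<bar> \<le> (m - l) * \<phi> t" for t
      using low[of t] up[of t] mult_neg_pos[OF lm(1) pos[of t]] mult_pos_pos[OF lm(2) pos[of t]]
      by (simp add: algebra_simps)
  qed (use lm in simp)
qed

text \<open>The bound makes \<open>\<phi> s * exp (\<kappa> * s)\<close> nondecreasing and
  \<open>\<phi> s * exp (- \<kappa> * s)\<close> nonincreasing in \<open>s\<close>; each settles one
  order of \<open>s\<close> and \<open>t\<close>.\<close>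

lemma deriv_bound_imp_harnack:
  fixes \<phi> \<phi>1 :: "real \<Rightarrow> real"
  assumes d1: "\<And>t. (\<phi> has_real_derivative \<phi>1 t) (at t)"
    and bound: "\<And>t. \<bar>\<phi>1 t\<bar> \<le> \<kappa> * \<phi> t"
  shows "\<phi> s \<le> \<phi> t * exp (\<kappa> * \<bar>t - s\<bar>)"
proof (cases "s \<le> t")
  case True
  have "\<phi> s * exp (\<kappa> * s) \<le> \<phi> t * exp (\<kappa> * t)"
  proof (rule DERIV_nonneg_imp_nondecreasing[OF True])
    fix x
    have "((\<lambda>s. \<phi> s * exp (\<kappa> * s)) has_real_derivative (\<phi>1 x + \<kappa> * \<phi> x) * exp (\<kappa> * x)) (at x)"
      by (auto intro!: derivative_eq_intros d1 simp: algebra_simps)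
    moreover have "\<phi>1 x + \<kappa> * \<phi> x \<ge> 0" using bound[of x] by linarith
    ultimately show "\<exists>y. ((\<lambda>s. \<phi> s * exp (\<kappa> * s)) has_real_derivative y) (at x) \<and> 0 \<le> y"
      by (meson exp_ge_zero mult_nonneg_nonneg)
  qed
  hence "\<phi> s * exp (\<kappa> * s) * exp (- \<kappa> * s) \<le> \<phi> t * exp (\<kappa> * t) * exp (- \<kappa> * s)"
    by (rule mult_right_mono) simp
  thus ?thesis
    using True by (simp add: mult.assoc flip: exp_add) (simp add: algebra_simps)
next
  case False
  hence "t \<le> s" by simp
  have "\<phi> s * exp (- \<kappa> * s) \<le> \<phi> t * exp (- \<kappa> * t)"
  proof (rule DERIV_nonpos_imp_nonincreasing[OF \<open>t \<le> s\<close>])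
    fix x
    have "((\<lambda>s. \<phi> s * exp (- \<kappa> * s)) has_real_derivative (\<phi>1 x - \<kappa> * \<phi> x) * exp (- \<kappa> * x)) (at x)"
      by (auto intro!: derivative_eq_intros d1 simp: algebra_simps)
    moreover have "\<phi>1 x - \<kappa> * \<phi> x \<le> 0" using bound[of x] by linarith
    ultimately show "\<exists>y. ((\<lambda>s. \<phi> s * exp (- \<kappa> * s)) has_real_derivative y) (at x) \<and> y \<le> 0"
      by (meson exp_ge_zero mult_nonpos_nonneg)
  qed
  hence "\<phi> s * exp (- \<kappa> * s) * exp (\<kappa> * s) \<le> \<phi> t * exp (- \<kappa> * t) * exp (\<kappa> * s)"
    by (rule mult_right_mono) simp
  thus ?thesis
    using False by (simp add: mult.assoc flip: exp_add) (simp add: algebra_simps)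
qed

section \<open>Touching a positive function from below by a Gaussian-damped exponential\<close>

text \<open>A negative \<open>D\<close> would make \<open>F1\<close> negative just to the right of
  its zero \<open>x\<close>, and the mean value theorem would produce a value below the
  minimum.\<close>

lemma second_deriv_nonneg_at_min:
  fixes F F1 :: "real \<Rightarrow> real"
  assumes d1: "\<And>t. (F has_real_derivative F1 t) (at t)"
    and d2: "(F1 has_real_derivative D) (at x)"
    and min: "\<And>t. F x \<le> F t"
  shows "F1 x = 0" "0 \<le> D"
proof -
  show z: "F1 x = 0"
    by (rule DERIV_local_min[OF d1, of 1]) (use min in auto)
  show "0 \<le> D"
  proof (rule ccontr)
    assume "\<not> 0 \<le> D"
    then obtain e where e: "e > 0" "\<And>y. 0 < y \<Longrightarrow> y < e \<Longrightarrow> F1 (x + y) < F1 x"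
      using DERIV_neg_dec_right[OF d2] by auto
    obtain y where y: "x < y" "y < x + e / 2" "F (x + e / 2) - F x = (x + e / 2 - x) * F1 y"
      using MVT2[of x "x + e / 2" F F1] d1 e(1) by auto
    have "F1 y < 0" using e(2)[of "y - x"] y z e(1) by simp
    hence "F (x + e / 2) < F x" using y(3) e(1) mult_pos_neg[of "e / 2" "F1 y"] by simp
    with min[of "x + e / 2"] show False by simp
  qed
qed

text \<open>The point \<open>t\<close> minimises
  \<open>\<phi> t * exp (\<rho> * (t - t0)\<^sup>2)\<close>: the first-order condition defines the
  slope \<open>z\<close>, the second-order condition bounds \<open>\<phi>2\<close>, and minimality
  itself is the global lower bound. The sign \<open>\<sigma>\<close> selects the side on which
  \<open>\<phi>\<close> is known to stay above \<open>\<phi> t0\<close>; this pushes the minimiser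
  to the other side and fixes the sign of \<open>z\<close>.\<close>

lemma touching_gaussian:
  fixes \<phi> \<phi>1 \<phi>2 :: "real \<Rightarrow> real"
  assumes d1: "\<And>t. (\<phi> has_real_derivative \<phi>1 t) (at t)"
    and d2: "\<And>t. (\<phi>1 has_real_derivative \<phi>2 t) (at t)"
    and pos: "\<And>t. \<phi> t > 0"
    and bound: "\<And>t. \<bar>\<phi>1 t\<bar> \<le> \<kappa> * \<phi> t"
    and "\<kappa> > 0" "\<rho> > 0" "\<bar>\<sigma>\<bar> = 1"
    and oneside: "\<And>t. 0 \<le> \<sigma> * (t - t0) \<Longrightarrow> \<sigma> * (t - t0) \<le> \<kappa> / \<rho> \<Longrightarrow> \<phi> t0 \<le> \<phi> t"
  obtains t z where "\<phi> t \<le> \<phi> t0" "0 \<le> \<sigma> * z" "\<phi>1 t = z * \<phi> t" "(z\<^sup>2 - 2 * \<rho>) * \<phi> t \<le> \<phi>2 t"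
    "\<And>r. \<phi> t * exp (- z * r - \<rho> * r\<^sup>2) \<le> \<phi> (t - r)"
proof -
  define F where "F = (\<lambda>t. \<phi> t * exp (\<rho> * (t - t0)\<^sup>2))"
  have contF: "continuous_on A F" for A
    unfolding F_def
    by (intro continuous_intros DERIV_continuous_on[of A \<phi> \<phi>1]) (use d1 DERIV_subset in blast)
  have r0: "\<kappa> / \<rho> > 0" using \<open>\<kappa> > 0\<close> \<open>\<rho> > 0\<close> by simp
  obtain x where x: "x \<in> cball t0 (\<kappa> / \<rho>)" "\<And>y. y \<in> cball t0 (\<kappa> / \<rho>) \<Longrightarrow> F x \<le> F y"
    using continuous_attains_inf[of "cball t0 (\<kappa> / \<rho>)" F] contF r0 by auto
  have F0: "F t0 = \<phi> t0" by (simp add: F_def)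
  have Fx0: "F x \<le> \<phi> t0" using x(2)[of t0] r0 F0 by simp
  \<comment> \<open>Beyond distance \<open>\<kappa> / \<rho>\<close> the Gaussian weight outgrows
    the exponential decay that Harnack permits, so the minimum over the ball is global.\<close>
  have min: "F x \<le> F t" for t
  proof (cases "t \<in> cball t0 (\<kappa> / \<rho>)")
    case False
    hence "\<kappa> / \<rho> \<le> \<bar>t - t0\<bar>" by (simp add: dist_real_def)
    hence "\<kappa> \<le> \<rho> * \<bar>t - t0\<bar>" using \<open>\<rho> > 0\<close> by (simp add: field_simps)
    hence "\<kappa> * \<bar>t - t0\<bar> \<le> \<rho> * \<bar>t - t0\<bar> * \<bar>t - t0\<bar>" by (rule mult_right_mono) simp
    hence le: "\<kappa> * \<bar>t - t0\<bar> \<le> \<rho> * (t - t0)\<^sup>2" by (simp add: power2_eq_square mult.assoc)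
    have "\<phi> t0 \<le> \<phi> t * exp (\<kappa> * \<bar>t - t0\<bar>)"
      by (rule deriv_bound_imp_harnack[OF d1 bound])
    also have "\<dots> \<le> F t" unfolding F_def
      using le pos[of t] by (intro mult_left_mono) auto
    finally show ?thesis using Fx0 by simp
  qed (rule x(2))
  define z where "z = - 2 * \<rho> * (x - t0)"
  have dF: "(F has_real_derivative (\<phi>1 t + 2 * \<rho> * (t - t0) * \<phi> t) * exp (\<rho> * (t - t0)\<^sup>2)) (at t)" for t
    unfolding F_def by (auto intro!: derivative_eq_intros d1 simp: algebra_simps)
  have ddF: "((\<lambda>t. (\<phi>1 t + 2 * \<rho> * (t - t0) * \<phi> t) * exp (\<rho> * (t - t0)\<^sup>2)) has_real_derivative
      (\<phi>2 x + 2 * \<rho> * \<phi> x + 2 * \<rho> * (x - t0) * \<phi>1 x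
       + (\<phi>1 x + 2 * \<rho> * (x - t0) * \<phi> x) * (2 * \<rho> * (x - t0))) * exp (\<rho> * (x - t0)\<^sup>2)) (at x)"
    by (auto intro!: derivative_eq_intros d1 d2 simp: algebra_simps)
  note crit = second_deriv_nonneg_at_min[OF dF ddF min]
  have slope: "\<phi>1 x = z * \<phi> x" using crit(1) by (simp add: z_def)
  have "0 \<le> \<phi>2 x + 2 * \<rho> * \<phi> x + 2 * \<rho> * (x - t0) * \<phi>1 x
       + (\<phi>1 x + 2 * \<rho> * (x - t0) * \<phi> x) * (2 * \<rho> * (x - t0))"
    using crit(2) by (simp add: zero_le_mult_iff)
  \<comment> \<open>By the first-order condition the last product vanishes, and
    \<open>2 * \<rho> * (x - t0) * \<phi>1 x\<close> equals
    \<open>- z\<^sup>2 * \<phi> x\<close>.\<close>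
  hence second: "(z\<^sup>2 - 2 * \<rho>) * \<phi> x \<le> \<phi>2 x"
    unfolding slope by (simp add: z_def algebra_simps power2_eq_square)
  have le: "\<phi> x \<le> \<phi> t0"
  proof -
    have "\<phi> x * 1 \<le> F x" unfolding F_def
      using pos[of x] \<open>\<rho> > 0\<close> by (intro mult_left_mono) auto
    with Fx0 show ?thesis by simp
  qed
  \<comment> \<open>A minimiser strictly on the \<open>\<sigma>\<close> side would carry a weight
    above 1 and a value \<open>\<phi> x \<ge> \<phi> t0\<close>, hence lose against
    \<open>t0\<close>.\<close>
  have "\<sigma> * (x - t0) \<le> 0"
  proof (rule ccontr)
    assume "\<not> \<sigma> * (x - t0) \<le> 0"
    hence s: "\<sigma> * (x - t0) > 0" by simp
    moreover have "\<sigma> * (x - t0) \<le> \<bar>\<sigma>\<bar> * \<bar>x - t0\<bar>"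
      by (metis abs_ge_self abs_mult)
    hence "\<sigma> * (x - t0) \<le> \<kappa> / \<rho>" using x(1) \<open>\<bar>\<sigma>\<bar> = 1\<close> by (simp add: dist_real_def)
    ultimately have "\<phi> t0 \<le> \<phi> x" by (intro oneside) auto
    moreover have "\<phi> x * 1 < F x" unfolding F_def
      using pos[of x] \<open>\<rho> > 0\<close> s by (intro mult_strict_left_mono) (auto intro!: mult_pos_pos)
    ultimately show False using Fx0 by simp
  qed
  hence "0 \<le> 2 * \<rho> * (- (\<sigma> * (x - t0)))" using \<open>\<rho> > 0\<close> by (intro mult_nonneg_nonneg) auto
  hence sgn: "0 \<le> \<sigma> * z" by (simp add: z_def algebra_simps)
  \<comment> \<open>Recentring the Gaussian at \<open>x\<close> turns the shift from
    \<open>t0\<close> into the linear exponent with slope \<open>z\<close>.\<close>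
  have "\<phi> x * exp (- z * r - \<rho> * r\<^sup>2) \<le> \<phi> (x - r)" for r
  proof -
    have "F x * exp (- \<rho> * (x - r - t0)\<^sup>2) \<le> F (x - r) * exp (- \<rho> * (x - r - t0)\<^sup>2)"
      by (rule mult_right_mono[OF min]) simp
    hence "\<phi> x * exp (\<rho> * (x - t0)\<^sup>2 - \<rho> * (x - r - t0)\<^sup>2) \<le> \<phi> (x - r)"
      unfolding F_def by (simp add: mult.assoc flip: exp_add)
    moreover have "\<rho> * (x - t0)\<^sup>2 - \<rho> * (x - r - t0)\<^sup>2 = - z * r - \<rho> * r\<^sup>2"
      by (simp add: z_def algebra_simps power2_eq_square)
    ultimately show ?thesis by simp
  qed
  with le sgn slope second show thesis by (rule that)
qed

section \<open>Limits of integrals and of difference quotients\<close>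

text \<open>The convergent bounds \<open>b\<close> make the liminf in Fatou's lemma finite, so
  integrability of the limit is a conclusion; it later supplies membership in
  \<open>chi_dom\<close>.\<close>

lemma fatou_tendsto:
  fixes u :: "nat \<Rightarrow> 'a \<Rightarrow> real"
  assumes int: "\<And>n. integrable M (u n)" and nonneg: "\<And>n x. 0 \<le> u n x"
    and lim: "\<And>x. (\<lambda>n. u n x) \<longlonglongrightarrow> v x"
    and le: "\<And>n. (LINT x|M. u n x) \<le> b n" and b: "b \<longlonglongrightarrow> B"
  shows "integrable M v" "(LINT x|M. v x) \<le> B"
proof -
  have v0: "0 \<le> v x" for x by (rule LIMSEQ_le_const[OF lim]) (use nonneg in auto)
  have meas: "v \<in> borel_measurable M"
    by (rule borel_measurable_LIMSEQ_real[OF lim]) (use int in auto)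
  have "(\<integral>\<^sup>+x. ennreal (v x) \<partial>M) = (\<integral>\<^sup>+x. liminf (\<lambda>n. ennreal (u n x)) \<partial>M)"
    by (intro nn_integral_cong) (metis lim lim_imp_Liminf sequentially_bot tendsto_ennrealI)
  also have "\<dots> \<le> liminf (\<lambda>n. \<integral>\<^sup>+x. ennreal (u n x) \<partial>M)"
    by (rule nn_integral_liminf) (use int in auto)
  also have "\<dots> \<le> liminf (\<lambda>n. ennreal (b n))"
    by (rule Liminf_mono, rule always_eventually, rule allI)
       (simp add: nn_integral_eq_integral[OF int] nonneg le ennreal_leI)
  also have "\<dots> = ennreal B"
    by (intro lim_imp_Liminf tendsto_ennrealI b) simp
  finally have fin: "(\<integral>\<^sup>+x. ennreal (v x) \<partial>M) \<le> ennreal B" .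
  show int_v: "integrable M v"
    by (rule integrableI_nonneg[OF meas]) (use v0 fin in \<open>auto simp: le_less_trans\<close>)
  have "0 \<le> (LINT x|M. u n x)" for n by (rule Bochner_Integration.integral_nonneg) (rule nonneg)
  hence "0 \<le> b n" for n using le order_trans by blast
  hence "0 \<le> B" by (intro LIMSEQ_le_const[OF b]) auto
  thus "(LINT x|M. v x) \<le> B"
    using fin nn_integral_eq_integral[OF int_v] v0 by simp
qed

text \<open>Here \<open>f'\<close> is a function vanishing at 0, so the ratio is its one-sided
  difference quotient along the sequence.\<close>

lemma ratio_tendsto:
  assumes "(f' has_real_derivative a) (at 0 within {0..})" "f' 0 = 0"
    and "x \<longlonglongrightarrow> 0" "\<And>n. x n > 0"
  shows "(\<lambda>n. f' (x n) / x n) \<longlonglongrightarrow> a"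
proof -
  have "filterlim x (at 0 within {0..}) sequentially"
    using assms(3,4) by (auto simp: filterlim_at less_imp_le eventually_sequentially less_imp_neq[symmetric])
  moreover have "((\<lambda>y. f' y / y) \<longlongrightarrow> a) (at 0 within {0..})"
    using assms(1,2) by (simp add: has_field_derivative_iff)
  ultimately show ?thesis by (rule filterlim_compose[rotated])
qed

section \<open>Exponents extracted from small values of a profile\<close>

text \<open>Fixes witnesses for both derivatives and a Harnack constant;
  \<open>exists_positive_profile\<close> shows that every positive bounded solution arises this
  way.\<close>

locale positive_profile =
  fixes K f g :: "real \<Rightarrow> real" and h c f0 g0 :: real and \<phi> \<phi>1 \<phi>2 :: "real \<Rightarrow> real" and \<kappa> :: real
  assumes kernel: "conv_kernel K" and F: "condF f g f0 g0"
    and d1: "\<And>t. (\<phi> has_real_derivative \<phi>1 t) (at t)"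
    and d2: "\<And>t. (\<phi>1 has_real_derivative \<phi>2 t) (at t)"
    and eq: "\<And>t. \<phi>2 t - c * \<phi>1 t - f (\<phi> t) + (LINT s|lborel. K s * g (\<phi> (t - s - c * h))) = 0"
    and pos: "\<And>t. \<phi> t > 0" and bdd: "bounded (range \<phi>)"
    and \<kappa>_pos: "\<kappa> > 0" and bound: "\<And>t. \<bar>\<phi>1 t\<bar> \<le> \<kappa> * \<phi> t"
begin

lemma harnack: "\<phi> s \<le> \<phi> t * exp (\<kappa> * \<bar>t - s\<bar>)"
  by (rule deriv_bound_imp_harnack[OF d1 bound])

lemma continuous_profile: "continuous_on A \<phi>"
  by (rule DERIV_continuous_on) (use d1 DERIV_subset in blast)

lemma g0_pos: "0 < g0"
  using F by (simp add: condF_def)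

lemma g_nonneg: "0 \<le> g (\<phi> t)"
  using F pos[of t] by (simp add: condF_def)

lemma birth_measurable: "(\<lambda>s. g (\<phi> (t - s - c * h))) \<in> borel_measurable borel"
proof (rule borel_measurable_continuous_onI)
  have "continuous_on {0..} g" using F by (simp add: condF_def)
  moreover have "continuous_on UNIV (\<lambda>s. \<phi> (t - s - c * h))"
    by (rule continuous_on_compose2[OF continuous_profile[of UNIV]]) (auto intro!: continuous_intros)
  ultimately show "continuous_on UNIV (\<lambda>s. g (\<phi> (t - s - c * h)))"
    by (rule continuous_on_compose2) (use pos in \<open>auto intro: less_imp_le\<close>)
qed

text \<open>The profile takes values in a compact interval, on which the continuous \<open>g\<close>
  is bounded, so a multiple of \<open>K\<close> dominates.\<close>

lemma birth_integrable: "integrable lborel (\<lambda>s. K s * g (\<phi> (t - s - c * h)))"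
proof -
  obtain M where M: "\<And>t. \<phi> t \<le> M"
    using bdd by (metis abs_le_D1 bounded_real rangeI)
  have "compact (g ` {0..M})"
    by (rule compact_continuous_image) (use F in \<open>auto simp: condF_def intro: continuous_on_subset\<close>)
  then obtain B where "\<And>x. x \<in> {0..M} \<Longrightarrow> \<bar>g x\<bar> \<le> B"
    by (meson bounded_real compact_imp_bounded image_eqI)
  hence B: "\<bar>g (\<phi> t)\<bar> \<le> B" for t using M pos by (simp add: less_imp_le)
  show ?thesis
  proof (rule Bochner_Integration.integrable_bound)
    show "integrable lborel (\<lambda>s. B * K s)"
      using kernel by (simp add: conv_kernel_def)
    show "(\<lambda>s. K s * g (\<phi> (t - s - c * h))) \<in> borel_measurable lborel"
      using kernel birth_measurable by (auto simp: conv_kernel_def)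
    show "AE s in lborel. norm (K s * g (\<phi> (t - s - c * h))) \<le> norm (B * K s)"
    proof (rule AE_I2)
      fix s
      have "K s * \<bar>g (\<phi> (t - s - c * h))\<bar> \<le> K s * \<bar>B\<bar>"
        using B[of "t - s - c * h"] kernel
        by (intro mult_left_mono) (auto simp: conv_kernel_def)
      thus "norm (K s * g (\<phi> (t - s - c * h))) \<le> norm (B * K s)"
        using kernel by (simp add: conv_kernel_def abs_mult mult.commute)
    qed
  qed
qed

text \<open>
  Passing to the limit at the touching points, only a lower bound of the nonlocal term is
  available away from them; Fatou's lemma turns it into convergence of the Laplace integral.
\<close>

lemma exponent_of_sequence:
  assumes lim: "(\<lambda>n. \<phi> (t0 n)) \<longlonglongrightarrow> 0" and "\<bar>\<sigma>\<bar> = 1"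
    and oneside: "\<And>n t. 0 \<le> \<sigma> * (t - t0 n) \<Longrightarrow> \<sigma> * (t - t0 n) \<le> real (Suc n) \<Longrightarrow> \<phi> (t0 n) \<le> \<phi> t"
  obtains z where "0 \<le> \<sigma> * z" "z \<in> chi_dom K" "chi1 K f0 g0 h z c \<le> 0"
proof -
  \<comment> \<open>This choice makes the radius \<open>\<kappa> / \<rho> n\<close> equal to the
    length \<open>real (Suc n)\<close> of the one-sided interval, while \<open>\<rho>\<close> still
    tends to 0.\<close>
  define \<rho> where "\<rho> n = \<kappa> / real (Suc n)" for n
  have \<rho>_pos: "\<rho> n > 0" for n using \<kappa>_pos by (simp add: \<rho>_def)
  have \<rho>_lim: "\<rho> \<longlonglongrightarrow> 0"
    using LIMSEQ_Suc[OF lim_const_over_n[of \<kappa>]] by (simp add: \<rho>_def[abs_def])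
  have \<kappa>\<rho>: "\<kappa> / \<rho> n = real (Suc n)" for n using \<kappa>_pos by (simp add: \<rho>_def)
  have "\<exists>t z. \<phi> t \<le> \<phi> (t0 n) \<and> 0 \<le> \<sigma> * z \<and> \<phi>1 t = z * \<phi> t \<and> (z\<^sup>2 - 2 * \<rho> n) * \<phi> t \<le> \<phi>2 t \<and>
      (\<forall>r. \<phi> t * exp (- z * r - \<rho> n * r\<^sup>2) \<le> \<phi> (t - r))" for n
  proof -
    have "\<phi> (t0 n) \<le> \<phi> t" if "0 \<le> \<sigma> * (t - t0 n)" "\<sigma> * (t - t0 n) \<le> \<kappa> / \<rho> n" for t
      using oneside that unfolding \<kappa>\<rho> by blast
    from touching_gaussian[OF d1 d2 pos bound \<kappa>_pos \<rho>_pos \<open>\<bar>\<sigma>\<bar> = 1\<close> this]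
    show ?thesis by metis
  qed
  then obtain t z where tz: "\<And>n. \<phi> (t n) \<le> \<phi> (t0 n)" "\<And>n. 0 \<le> \<sigma> * z n" "\<And>n. \<phi>1 (t n) = z n * \<phi> (t n)"
      "\<And>n. ((z n)\<^sup>2 - 2 * \<rho> n) * \<phi> (t n) \<le> \<phi>2 (t n)"
      "\<And>n r. \<phi> (t n) * exp (- z n * r - \<rho> n * r\<^sup>2) \<le> \<phi> (t n - r)"
    by metis
  have t_lim: "(\<lambda>n. \<phi> (t n)) \<longlonglongrightarrow> 0"
    by (rule tendsto_sandwich[OF _ _ tendsto_const lim]) (auto intro!: always_eventually tz(1) less_imp_le[OF pos])
  \<comment> \<open>The slopes are logarithmic derivatives of \<open>\<phi>\<close>, hence bounded,
    and a subsequence converges.\<close>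
  have "\<bar>z n\<bar> \<le> \<kappa>" for n
    using bound[of "t n"] pos[of "t n"] by (simp add: tz(3) abs_mult)
  hence "bounded (range z)" by (auto simp: bounded_real)
  then obtain Z k where k: "strict_mono (k :: nat \<Rightarrow> nat)" and "(z \<circ> k) \<longlonglongrightarrow> Z"
    using bounded_imp_convergent_subsequence by blast
  hence z_lim: "(\<lambda>n. z (k n)) \<longlonglongrightarrow> Z" by (simp add: o_def)
  have \<rho>k: "(\<lambda>n. \<rho> (k n)) \<longlonglongrightarrow> 0"
    using LIMSEQ_subseq_LIMSEQ[OF \<rho>_lim k] by (simp add: o_def)
  have tk: "(\<lambda>n. \<phi> (t (k n))) \<longlonglongrightarrow> 0"
    using LIMSEQ_subseq_LIMSEQ[OF t_lim k] by (simp add: o_def)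
  define q where "q x = g x / x" for x
  \<comment> \<open>The nonlocal integrand divided by \<open>\<phi> (t (k n))\<close>, with the
    quotient of profile values replaced by its lower bound from touching at
    \<open>r = s + c * h\<close>.\<close>
  define u where "u n s = K s * (q (\<phi> (t (k n) - s - c * h)) *
      exp (- z (k n) * (s + c * h) - \<rho> (k n) * (s + c * h)\<^sup>2))" for n s
  have K0: "0 \<le> K s" for s using kernel by (simp add: conv_kernel_def)
  have q0: "0 \<le> q (\<phi> s)" for s using g_nonneg[of s] pos[of s] by (simp add: q_def)
  have u0: "0 \<le> u n s" for n s
    unfolding u_def using K0 q0 by (intro mult_nonneg_nonneg) auto
  have u_le: "u n s \<le> inverse (\<phi> (t (k n))) * (K s * g (\<phi> (t (k n) - s - c * h)))" for n s
  proof -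
    let ?x = "t (k n) - s - c * h" and ?e = "exp (- z (k n) * (s + c * h) - \<rho> (k n) * (s + c * h)\<^sup>2)"
    have "\<phi> (t (k n)) * ?e \<le> \<phi> ?x"
      using tz(5)[of "k n" "s + c * h"] by (simp add: algebra_simps)
    hence "?e \<le> \<phi> ?x / \<phi> (t (k n))" using pos[of "t (k n)"] by (simp add: field_simps)
    hence "q (\<phi> ?x) * ?e \<le> q (\<phi> ?x) * (\<phi> ?x / \<phi> (t (k n)))"
      by (rule mult_left_mono[OF _ q0])
    also have "\<dots> = inverse (\<phi> (t (k n))) * g (\<phi> ?x)"
      using pos[of ?x] by (simp add: q_def field_simps)
    finally have "u n s \<le> K s * (inverse (\<phi> (t (k n))) * g (\<phi> ?x))"
      unfolding u_def by (rule mult_left_mono[OF _ K0])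
    thus ?thesis by (simp only: mult.left_commute)
  qed
  have u_int: "integrable lborel (u n)" for n
  proof (rule Bochner_Integration.integrable_bound)
    show "integrable lborel (\<lambda>s. inverse (\<phi> (t (k n))) * (K s * g (\<phi> (t (k n) - s - c * h))))"
      using birth_integrable by simp
    have "(\<lambda>s. \<phi> (t (k n) - s - c * h)) \<in> borel_measurable borel"
      by (rule borel_measurable_continuous_onI,
          rule continuous_on_compose2[OF continuous_profile[of UNIV]]) (auto intro!: continuous_intros)
    moreover note birth_measurable[of "t (k n)"]
    moreover have "K \<in> borel_measurable lborel" using kernel by (auto simp: conv_kernel_def)
    ultimately show "u n \<in> borel_measurable lborel"
      unfolding u_def q_def by measurable
    show "AE s in lborel. norm (u n s) \<le> norm (inverse (\<phi> (t (k n))) * (K s * g (\<phi> (t (k n) - s - c * h))))"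
      using u_le u0 by (auto intro!: AE_I2 order_trans[OF _ abs_ge_self])
  qed
  \<comment> \<open>Dividing the equation at the touching point by \<open>\<phi> (t (k n))\<close>
    and inserting the second-order inequality bounds the nonlocal term by
    \<open>b n\<close>.\<close>
  define b where "b n = f (\<phi> (t (k n))) / \<phi> (t (k n)) + c * z (k n) - (z (k n))\<^sup>2 + 2 * \<rho> (k n)" for n
  have u_b: "(LINT s|lborel. u n s) \<le> b n" for n
  proof -
    have p: "\<phi> (t (k n)) > 0" by (rule pos)
    have "(LINT s|lborel. u n s) \<le> (LINT s|lborel. inverse (\<phi> (t (k n))) * (K s * g (\<phi> (t (k n) - s - c * h))))"
      by (rule integral_mono[OF u_int integrable_mult_right[OF birth_integrable] u_le])
    also have "\<dots> = inverse (\<phi> (t (k n))) * (LINT s|lborel. K s * g (\<phi> (t (k n) - s - c * h)))"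
      by simp
    also have "\<dots> = inverse (\<phi> (t (k n))) * (f (\<phi> (t (k n))) + c * (z (k n) * \<phi> (t (k n))) - \<phi>2 (t (k n)))"
      using eq[of "t (k n)"] tz(3) by simp
    also have "\<dots> \<le> inverse (\<phi> (t (k n))) * (f (\<phi> (t (k n))) + c * (z (k n) * \<phi> (t (k n)))
        - ((z (k n))\<^sup>2 - 2 * \<rho> (k n)) * \<phi> (t (k n)))"
      using tz(4)[of "k n"] p by (intro mult_left_mono) auto
    also have "\<dots> = b n" using p by (simp add: b_def field_simps)
    finally show ?thesis .
  qed
  have b_lim: "b \<longlonglongrightarrow> f0 + c * Z - Z\<^sup>2 + 2 * 0"
    unfolding b_def using F
    by (intro tendsto_intros ratio_tendsto z_lim \<rho>k tk pos) (auto simp: condF_def)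
  have u_lim: "(\<lambda>n. u n s) \<longlonglongrightarrow> K s * (g0 * exp (- Z * (s + c * h) - 0 * (s + c * h)\<^sup>2))" for s
  proof -
    \<comment> \<open>Harnack carries the smallness at \<open>t (k n)\<close> to every fixed shift,
      so \<open>q\<close> can be evaluated in the limit.\<close>
    have "(\<lambda>n. \<phi> (t (k n) - s - c * h)) \<longlonglongrightarrow> 0"
    proof (rule tendsto_sandwich[OF _ _ tendsto_const])
      show "\<forall>\<^sub>F n in sequentially. 0 \<le> \<phi> (t (k n) - s - c * h)"
        by (auto intro: always_eventually less_imp_le[OF pos])
      show "\<forall>\<^sub>F n in sequentially. \<phi> (t (k n) - s - c * h) \<le> \<phi> (t (k n)) * exp (\<kappa> * \<bar>s + c * h\<bar>)"
        using harnack[of "t (k n) - s - c * h" "t (k n)" for n]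
        by (auto intro!: always_eventually simp: algebra_simps)
      show "(\<lambda>n. \<phi> (t (k n)) * exp (\<kappa> * \<bar>s + c * h\<bar>)) \<longlonglongrightarrow> 0"
        by (rule tendsto_mult_left_zero[OF tk])
    qed
    hence "(\<lambda>n. q (\<phi> (t (k n) - s - c * h))) \<longlonglongrightarrow> g0"
      unfolding q_def using F by (intro ratio_tendsto pos) (auto simp: condF_def)
    thus ?thesis unfolding u_def by (intro tendsto_intros z_lim \<rho>k)
  qed
  have v_eq: "K s * (g0 * exp (- Z * (s + c * h) - 0 * (s + c * h)\<^sup>2))
      = g0 * exp (- Z * c * h) * (K s * exp (- Z * s))" for s
    by (simp add: algebra_simps flip: exp_add)
  \<comment> \<open>Integrability gives \<open>Z \<in> chi_dom K\<close>, and the integral bound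
    rearranges to \<open>chi1 K f0 g0 h Z c \<le> 0\<close>.\<close>
  note fatou = fatou_tendsto[OF u_int u0 u_lim u_b b_lim, unfolded v_eq]
  show thesis
  proof (rule that[of Z])
    have "(\<lambda>n. \<sigma> * z (k n)) \<longlonglongrightarrow> \<sigma> * Z" by (intro tendsto_intros z_lim)
    thus "0 \<le> \<sigma> * Z" by (rule LIMSEQ_le_const) (use tz(2) in auto)
    show "Z \<in> chi_dom K" using fatou(1) g0_pos by (simp add: chi_dom_def)
    show "chi1 K f0 g0 h Z c \<le> 0" using fatou(2) by (simp add: chi1_def)
  qed
qed

text \<open>Walk from \<open>s\<close>, where \<open>\<phi>\<close> is at least
  \<open>\<delta>\<close>, towards \<open>b\<close> and stop at the first point of a low sublevel
  set. Harnack makes that walk long, and \<open>\<phi>\<close> is higher all along it, so the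
  stopping points satisfy the one-sided condition of \<open>exponent_of_sequence\<close>.\<close>

lemma exponent_of_descent:
  assumes "\<bar>\<sigma>\<bar> = 1" "\<delta> > 0"
    and desc: "\<And>e. e > 0 \<Longrightarrow> \<exists>s b. 0 \<le> \<sigma> * (s - b) \<and> \<delta> \<le> \<phi> s \<and> \<phi> b \<le> e"
  obtains z where "0 \<le> \<sigma> * z" "z \<in> chi_dom K" "chi1 K f0 g0 h z c \<le> 0"
proof -
  have \<sigma>: "\<sigma> = 1 \<or> \<sigma> = - 1" using \<open>\<bar>\<sigma>\<bar> = 1\<close> by linarith
  \<comment> \<open>By Harnack, a drop from \<open>\<delta>\<close> to \<open>e n\<close> takes at
    least the distance \<open>real (Suc n)\<close>.\<close>
  define e where "e n = \<delta> * exp (- \<kappa> * real (Suc n))" for n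
  have e_pos: "e n > 0" for n using \<open>\<delta> > 0\<close> by (simp add: e_def)
  have e_lim: "e \<longlonglongrightarrow> 0"
  proof -
    have "filterlim (\<lambda>n. \<kappa> * real n) at_top sequentially"
      by (rule filterlim_tendsto_pos_mult_at_top[OF tendsto_const \<kappa>_pos filterlim_real_sequentially])
    hence "filterlim (\<lambda>n. \<kappa> * real (Suc n)) at_top sequentially"
      by (rule filterlim_compose) (rule filterlim_Suc)
    hence "(\<lambda>n. exp (- (\<kappa> * real (Suc n)))) \<longlonglongrightarrow> 0"
      by (intro filterlim_compose[OF exp_at_bot] filterlim_compose[OF filterlim_uminus_at_bot_at_top])
    from tendsto_mult_right_zero[OF this, of \<delta>] show ?thesis by (simp add: e_def[abs_def])
  qed
  have "\<exists>a. \<phi> a \<le> e n \<and> (\<forall>t. 0 \<le> \<sigma> * (t - a) \<and> \<sigma> * (t - a) \<le> real (Suc n) \<longrightarrow> \<phi> a \<le> \<phi> t)" for n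
  proof -
    obtain s b where sb: "0 \<le> \<sigma> * (s - b)" "\<delta> \<le> \<phi> s" "\<phi> b \<le> e n" using desc[OF e_pos] by blast
    \<comment> \<open>The point of this compact set nearest to \<open>s\<close> is the first one met
      on the way to \<open>b\<close>.\<close>
    define S where "S = {min s b..max s b} \<inter> {t. \<phi> t \<le> e n}"
    have "compact S" unfolding S_def
      by (intro compact_Int_closed closed_Collect_le continuous_profile) auto
    moreover have "b \<in> S" using sb by (auto simp: S_def)
    moreover have "continuous_on S (\<lambda>t. \<bar>t - s\<bar>)" by (intro continuous_intros)
    ultimately obtain a where a: "a \<in> S" "\<And>t. t \<in> S \<Longrightarrow> \<bar>a - s\<bar> \<le> \<bar>t - s\<bar>"
      using continuous_attains_inf[of S "\<lambda>t. \<bar>t - s\<bar>"] by auto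
    have a_e: "\<phi> a \<le> e n" using a by (simp add: S_def)
    have "\<delta> \<le> \<phi> a * exp (\<kappa> * \<bar>a - s\<bar>)" using sb(2) harnack[of s a] by linarith
    also have "\<dots> \<le> e n * exp (\<kappa> * \<bar>a - s\<bar>)" by (rule mult_right_mono[OF a_e]) simp
    also have "\<dots> = \<delta> * exp (\<kappa> * (\<bar>a - s\<bar> - real (Suc n)))"
      by (simp add: e_def mult.assoc algebra_simps flip: exp_add)
    finally have far: "real (Suc n) \<le> \<bar>a - s\<bar>"
      using \<open>\<delta> > 0\<close> \<kappa>_pos by (simp add: zero_le_mult_iff)
    \<comment> \<open>By \<open>far\<close>, such a \<open>t\<close> lies between \<open>a\<close>
      and \<open>s\<close>. In the sublevel set it would have to be \<open>a\<close> itself;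
      otherwise \<open>\<phi> t\<close> exceeds \<open>e n\<close>.\<close>
    have "\<phi> a \<le> \<phi> t" if t: "0 \<le> \<sigma> * (t - a)" "\<sigma> * (t - a) \<le> real (Suc n)" for t
    proof (cases "\<phi> t \<le> e n")
      case True
      have "t \<in> S" using \<sigma> sb(1) a(1) far t True by (auto simp: S_def)
      from a(2)[OF this] have "t = a" using \<sigma> sb(1) a(1) far t by (auto simp: S_def)
      thus ?thesis by simp
    qed (use a_e in simp)
    with a_e show ?thesis by blast
  qed
  then obtain a where a: "\<And>n. \<phi> (a n) \<le> e n"
      "\<And>n t. 0 \<le> \<sigma> * (t - a n) \<Longrightarrow> \<sigma> * (t - a n) \<le> real (Suc n) \<Longrightarrow> \<phi> (a n) \<le> \<phi> t"
    by metis
  have "(\<lambda>n. \<phi> (a n)) \<longlonglongrightarrow> 0"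
    by (rule tendsto_sandwich[OF _ _ tendsto_const e_lim]) (auto intro!: always_eventually a(1) less_imp_le[OF pos])
  from exponent_of_sequence[OF this \<open>\<bar>\<sigma>\<bar> = 1\<close> a(2)] show thesis using that by blast
qed

end

text \<open>As \<open>f\<close> is Lipschitz on the range of \<open>\<phi>\<close>, vanishes at 0,
  and the birth term is nonnegative, \<open>\<phi>\<close> is a supersolution of a linear
  equation.\<close>

lemma exists_positive_profile:
  assumes "conv_kernel K" "condF f g f0 g0" "pos_bdd_solution K f g h c \<phi>"
  obtains \<phi>1 \<phi>2 \<kappa> where "positive_profile K f g h c f0 g0 \<phi> \<phi>1 \<phi>2 \<kappa>"
proof -
  obtain \<phi>1 \<phi>2 where d: "\<And>t. (\<phi> has_real_derivative \<phi>1 t) (at t)" "\<And>t. (\<phi>1 has_real_derivative \<phi>2 t) (at t)"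
      and eq: "\<And>t. \<phi>2 t - c * \<phi>1 t - f (\<phi> t) + (LINT s|lborel. K s * g (\<phi> (t - s - c * h))) = 0"
      and pos: "\<And>t. \<phi> t > 0" and bdd: "bounded (range \<phi>)"
    using assms(3) unfolding pos_bdd_solution_def tw_solution_def by blast
  obtain M where M: "\<And>t. \<phi> t \<le> M"
    using bdd by (metis abs_le_D1 bounded_real rangeI)
  obtain L where L: "lipschitz_on L {0..M} f" using assms(2) unfolding condF_def by blast
  \<comment> \<open>Adding 1 makes the coefficient strictly positive, as
    \<open>supersolution_deriv_bound\<close> demands.\<close>
  have f_le: "f (\<phi> t) \<le> (\<bar>L\<bar> + 1) * \<phi> t" for t
  proof -
    have "dist (f (\<phi> t)) (f 0) \<le> L * dist (\<phi> t) 0"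
      using pos[of t] M[of t] by (intro lipschitz_onD[OF L]) auto
    hence "f (\<phi> t) \<le> L * \<phi> t"
      using assms(2) pos[of t] by (simp add: condF_def dist_real_def)
    also have "\<dots> \<le> (\<bar>L\<bar> + 1) * \<phi> t" using pos[of t] by (intro mult_right_mono) auto
    finally show ?thesis .
  qed
  have birth: "0 \<le> (LINT s|lborel. K s * g (\<phi> (t - s - c * h)))" for t
    using assms(1,2) pos
    by (intro Bochner_Integration.integral_nonneg mult_nonneg_nonneg)
       (auto simp: conv_kernel_def condF_def less_imp_le)
  have "\<phi>2 t - c * \<phi>1 t - (\<bar>L\<bar> + 1) * \<phi> t \<le> 0" for t
    using eq[of t] f_le[of t] birth[of t] by linarith
  from supersolution_deriv_bound[OF d pos this]
  obtain \<kappa> where "\<kappa> > 0" "\<And>t. \<bar>\<phi>1 t\<bar> \<le> \<kappa> * \<phi> t"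
    using abs_ge_zero[of L] by (metis add_nonneg_pos zero_less_one)
  thus thesis
    by (intro that[of \<phi>1 \<phi>2 \<kappa>] positive_profile.intro assms(1,2) d eq pos bdd)
qed

section \<open>The characteristic function and the critical speed\<close>

text \<open>At 0 the function has the positive value \<open>g0 - f0\<close>. Since 0 is the mean of
  \<open>x\<close> and \<open>y\<close> with weights proportional to \<open>- y\<close> and
  \<open>x\<close>, convexity forbids nonpositive values at both.\<close>

lemma chi1_nonpos_same_sign:
  assumes K: "conv_kernel K" and "f0 < g0" "0 < g0"
    and x: "x \<in> chi_dom K" "chi1 K f0 g0 h x c \<le> 0"
    and y: "y \<in> chi_dom K" "chi1 K f0 g0 h y c \<le> 0"
    and "0 \<le> x" "y \<le> 0"
  shows False
proof -
  define I where "I z = (LINT s|lborel. K s * exp (- z * s))" for z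
  define E where "E z = exp (- z * c * h) * I z" for z
  have chi: "chi1 K f0 g0 h z c = z\<^sup>2 - c * z - f0 + g0 * E z" for z
    by (simp add: chi1_def E_def I_def)
  have E0: "E 0 = 1" using K by (simp add: E_def I_def conv_kernel_def)
  have "x \<noteq> 0" "y \<noteq> 0" using x y E0 \<open>f0 < g0\<close> by (auto simp: chi)
  hence xy: "0 < x" "y < 0" using assms(8,9) by auto
  have int: "integrable lborel (\<lambda>s. K s * exp (- z * s))" if "z = x \<or> z = y" for z
    using that x(1) y(1) by (auto simp: chi_dom_def)
  have E_eq: "E z = (LINT s|lborel. K s * exp (- z * (s + c * h)))"
    and E_int: "integrable lborel (\<lambda>s. K s * exp (- z * (s + c * h)))" if "z = x \<or> z = y" for z
  proof -
    have *: "K s * exp (- z * (s + c * h)) = exp (- z * c * h) * (K s * exp (- z * s))" for s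
      by (simp add: algebra_simps flip: exp_add)
    show "E z = (LINT s|lborel. K s * exp (- z * (s + c * h)))"
      unfolding * E_def I_def by simp
    show "integrable lborel (\<lambda>s. K s * exp (- z * (s + c * h)))"
      unfolding * using int[OF that] by simp
  qed
  txt \<open>Convexity in the exponent, tested at 0 = (- y) * x + x * y through the tangent of exp at 0.\<close>
  have "(x - y) * (LINT s|lborel. K s) = (LINT s|lborel. (x - y) * K s)" by simp
  also have "\<dots> \<le> (LINT s|lborel. - y * (K s * exp (- x * (s + c * h))) + x * (K s * exp (- y * (s + c * h))))"
  proof (rule integral_mono)
    show "integrable lborel (\<lambda>s. (x - y) * K s)" using K by (simp add: conv_kernel_def)
    show "integrable lborel (\<lambda>s. - y * (K s * exp (- x * (s + c * h))) + x * (K s * exp (- y * (s + c * h))))"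
      using E_int by simp
    fix s
    have "- y * (1 + - x * (s + c * h)) + x * (1 + - y * (s + c * h))
        \<le> - y * exp (- x * (s + c * h)) + x * exp (- y * (s + c * h))"
      using xy by (intro add_mono mult_left_mono exp_ge_add_one_self) auto
    hence "x - y \<le> - y * exp (- x * (s + c * h)) + x * exp (- y * (s + c * h))"
      by (simp add: algebra_simps)
    hence "K s * (x - y) \<le> K s * (- y * exp (- x * (s + c * h)) + x * exp (- y * (s + c * h)))"
      using K by (intro mult_left_mono) (auto simp: conv_kernel_def)
    thus "(x - y) * K s \<le> - y * (K s * exp (- x * (s + c * h))) + x * (K s * exp (- y * (s + c * h)))"
      by (simp add: algebra_simps)
  qed
  also have "\<dots> = - y * E x + x * E y"
    using E_int by (simp add: E_eq)
  finally have conv: "x - y \<le> - y * E x + x * E y" using K by (simp add: conv_kernel_def)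
  have "g0 * (x - y) \<le> g0 * (- y * E x + x * E y)"
    by (rule mult_left_mono[OF conv]) (use \<open>0 < g0\<close> in simp)
  moreover have "f0 * (x - y) < g0 * (x - y)" using xy \<open>f0 < g0\<close> by simp
  moreover have "- y * chi1 K f0 g0 h x c + x * chi1 K f0 g0 h y c \<le> 0"
    using x(2) y(2) xy by (intro add_nonpos_nonpos mult_nonneg_nonpos) auto
  \<comment> \<open>In this combination the terms linear in \<open>c\<close> cancel, and the squares
    leave a nonnegative product.\<close>
  moreover have "- y * chi1 K f0 g0 h x c + x * chi1 K f0 g0 h y c
      = x * (- y) * (x - y) - f0 * (x - y) + g0 * (- y * E x + x * E y)"
    unfolding chi by (simp add: algebra_simps power2_eq_square)
  moreover have "0 \<le> x * (- y) * (x - y)" using xy by (intro mult_nonneg_nonneg) auto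
  ultimately show False by linarith
qed

lemma chi1_nonpos_imp_nonzero:
  assumes "conv_kernel K" "f0 < g0" "chi1 K f0 g0 h z c \<le> 0"
  shows "z \<noteq> 0"
  using assms by (auto simp: chi1_def conv_kernel_def)

text \<open>The zero is found by lowering the speed at a fixed exponent, so no regularity in the exponent is needed.\<close>

lemma cstar_plus_le:
  assumes "conv_kernel K" "0 \<le> h" "0 \<le> g0" "0 < z" "z \<in> chi_dom K" "chi1 K f0 g0 h z c \<le> 0"
  shows "cstar_plus K f0 g0 h \<le> ereal c"
proof -
  define I where "I = (LINT s|lborel. K s * exp (- z * s))"
  have I: "0 \<le> I" unfolding I_def
    using assms(1) by (intro Bochner_Integration.integral_nonneg) (auto simp: conv_kernel_def)
  have chi: "chi1 K f0 g0 h z x = z\<^sup>2 - x * z - f0 + g0 * exp (- z * x * h) * I" for x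
    by (simp add: chi1_def I_def)
  \<comment> \<open>At a speed of at most \<open>- f0 / z\<close> the term \<open>- a * z\<close>
    compensates \<open>- f0\<close>, which makes \<open>chi1\<close> nonnegative; the minimum keeps
    \<open>a \<le> c\<close>.\<close>
  define a where "a = min c (- f0 / z)"
  have "0 \<le> chi1 K f0 g0 h z a"
  proof -
    have "a * z \<le> - f0" using \<open>0 < z\<close> by (simp add: a_def min_def field_simps)
    moreover have "0 \<le> g0 * exp (- z * a * h) * I" using I \<open>0 \<le> g0\<close> by simp
    ultimately show ?thesis unfolding chi using zero_le_power2[of z] by linarith
  qed
  moreover have "continuous_on {a..c} (chi1 K f0 g0 h z)"
    unfolding chi by (intro continuous_intros)
  ultimately obtain x where "a \<le> x" "x \<le> c" "chi1 K f0 g0 h z x = 0"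
    using IVT2'[of "chi1 K f0 g0 h z" c 0 a] assms(6) by (auto simp: a_def)
  hence "cstar_plus K f0 g0 h \<le> ereal x"
    unfolding cstar_plus_def using assms(4,5) by (intro Inf_lower) blast
  thus ?thesis using \<open>x \<le> c\<close> by (meson ereal_less_eq(3) order_trans)
qed

text \<open>For a speed below \<open>B \<le> 0\<close> the delay factor is at least 1. If
  \<open>z \<le> \<delta>\<close>, the nonlocal term alone compensates \<open>- f0\<close>; if
  \<open>z > \<delta>\<close>, the term \<open>- x * z\<close> does. The square then makes
  \<open>chi1\<close> positive, so no admissible zero exists.\<close>

lemma cstar_plus_bounded_below:
  assumes K: "conv_kernel K" and "0 \<le> h" "0 < f0" "f0 < g0"
  shows "cstar_plus K f0 g0 h \<noteq> - \<infinity>"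
proof -
  have Kint: "integrable lborel K" and K0: "\<And>s. 0 \<le> K s" using K by (auto simp: conv_kernel_def)
  \<comment> \<open>The mass of \<open>K\<close> left of \<open>n\<close> tends to 1, hence
    eventually exceeds \<open>f0 / g0\<close>.\<close>
  define m where "m n = (LINT s|lborel. K s * indicator {..real n} s)" for n
  have "m \<longlonglongrightarrow> (LINT s|lborel. K s)"
    unfolding m_def
  proof (rule integral_dominated_convergence[where w = K])
    show "AE s in lborel. (\<lambda>n. K s * indicator {..real n} s) \<longlonglongrightarrow> K s"
    proof (rule AE_I2)
      fix s
      have "\<forall>\<^sub>F n in sequentially. K s * indicator {..real n} s = K s"
        using eventually_ge_at_top[of "nat \<lceil>s\<rceil>"] by eventually_elim (auto simp: indicator_def nat_ceiling_le_eq)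
      thus "(\<lambda>n. K s * indicator {..real n} s) \<longlonglongrightarrow> K s" by (rule tendsto_eventually)
    qed
  qed (use Kint K0 in \<open>auto simp: indicator_def\<close>)
  moreover have "f0 / g0 < (LINT s|lborel. K s)" using K assms(3,4) by (simp add: conv_kernel_def)
  ultimately have "\<forall>\<^sub>F n in sequentially. f0 / g0 < m n" by (rule order_tendstoD)
  then obtain n where "f0 / g0 < m n" by (auto simp: eventually_sequentially)
  hence mn: "f0 < g0 * m n" using assms(3,4) by (simp add: field_simps)
  \<comment> \<open>Adding 1 keeps \<open>M\<close> positive when \<open>n\<close> is 0. The
    exponent \<open>\<delta>\<close> solves \<open>g0 * m n * exp (- \<delta> * M) = f0\<close>, and
    \<open>B\<close> is chosen with \<open>B * \<delta> = - f0\<close>.\<close>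
  define M where "M = real n + 1"
  have M: "M > 0" by (simp add: M_def)
  define \<delta> where "\<delta> = ln (g0 * m n / f0) / M"
  have \<delta>: "\<delta> > 0" using mn assms(3) M by (simp add: \<delta>_def)
  define B where "B = - f0 / \<delta>"
  have B: "B \<le> 0" using \<delta> assms(3) by (simp add: B_def divide_nonpos_pos)
  have "B \<le> x" if z: "0 < z" "z \<in> chi_dom K" "chi1 K f0 g0 h z x = 0" for z x
  proof (rule ccontr)
    assume "\<not> B \<le> x"
    hence x: "x < B" by simp
    have J: "m n * exp (- z * M) \<le> (LINT s|lborel. K s * exp (- z * s))"
    proof -
      have "m n * exp (- z * M) = (LINT s|lborel. K s * indicator {..real n} s * exp (- z * M))"
        by (simp add: m_def)
      also have "\<dots> \<le> (LINT s|lborel. K s * exp (- z * s))"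
      proof (rule integral_mono)
        show "integrable lborel (\<lambda>s. K s * indicator {..real n} s * exp (- z * M))"
          using integrable_real_mult_indicator[of "{..real n}" lborel K] Kint by (simp add: mult.commute)
        show "integrable lborel (\<lambda>s. K s * exp (- z * s))" using z(2) by (simp add: chi_dom_def)
        show "K s * indicator {..real n} s * exp (- z * M) \<le> K s * exp (- z * s)" for s
          using K0[of s] z(1) by (auto simp: indicator_def M_def intro!: mult_left_mono)
      qed
      finally show ?thesis .
    qed
    have m0: "0 < m n" using mn assms(3,4) by (smt (verit) mult_nonneg_nonpos)
    have "0 \<le> - z * x * h"
      using z(1) x B \<open>0 \<le> h\<close> by (intro mult_nonneg_nonneg mult_nonpos_nonpos) auto
    hence "1 * (m n * exp (- z * M)) \<le> exp (- z * x * h) * (LINT s|lborel. K s * exp (- z * s))"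
      using m0 by (intro mult_mono J) auto
    hence ge: "g0 * (m n * exp (- z * M)) \<le> g0 * exp (- z * x * h) * (LINT s|lborel. K s * exp (- z * s))"
      using assms(3,4) by simp
    have "z\<^sup>2 > 0" using z(1) by simp
    show False
    proof (cases "z \<le> \<delta>")
      case True
      hence "exp (z * M) \<le> exp (\<delta> * M)" using M by simp
      also have "\<dots> = g0 * m n / f0" using mn assms(3) M by (simp add: \<delta>_def)
      finally have "f0 \<le> g0 * (m n * exp (- z * M))"
        using assms(3) by (simp add: field_simps exp_minus)
      moreover have "x * z \<le> 0" using z(1) x B by (simp add: mult_nonpos_nonneg)
      ultimately show False using z(3) ge \<open>z\<^sup>2 > 0\<close> unfolding chi1_def by linarith
    next
      case False
      have "x * z \<le> B * z" using x z(1) by simp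
      also have "\<dots> \<le> B * \<delta>" using False B by (intro mult_left_mono_neg) auto
      also have "\<dots> = - f0" using \<delta> by (simp add: B_def)
      finally have "x * z \<le> - f0" .
      moreover have "0 \<le> g0 * (m n * exp (- z * M))" using m0 assms(3,4) by simp
      ultimately show False using z(3) ge \<open>z\<^sup>2 > 0\<close> unfolding chi1_def by linarith
    qed
  qed
  hence "ereal B \<le> cstar_plus K f0 g0 h"
    unfolding cstar_plus_def by (intro Inf_greatest) auto
  thus ?thesis by auto
qed

section \<open>Convergence at minus infinity\<close>

text \<open>Small values far to the left of 0 yield a positive exponent. Without convergence, values
  above some \<open>\<delta>\<close> also recur to the left of small ones, and the opposite descent
  yields a nonpositive exponent for the same \<open>c\<close>.\<close>

lemma vanishing_at_bot:
  assumes K: "conv_kernel K" and F: "condF f g f0 g0"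
    and sol: "pos_bdd_solution K f g h c \<phi>" and liminf: "Liminf at_bot (\<lambda>s. ereal (\<phi> s)) = 0"
  shows "(\<phi> \<longlongrightarrow> 0) at_bot" "\<exists>z>0. z \<in> chi_dom K \<and> chi1 K f0 g0 h z c \<le> 0"
proof -
  obtain \<phi>1 \<phi>2 \<kappa> where "positive_profile K f g h c f0 g0 \<phi> \<phi>1 \<phi>2 \<kappa>"
    using exists_positive_profile[OF K F sol] .
  then interpret positive_profile K f g h c f0 g0 \<phi> \<phi>1 \<phi>2 \<kappa> .
  have fg: "f0 < g0" using F by (simp add: condF_def)
  have small: "\<exists>b\<le>T. \<phi> b \<le> e" if "e > 0" for e T
  proof (rule ccontr)
    assume "\<not> (\<exists>b\<le>T. \<phi> b \<le> e)"
    hence "\<forall>\<^sub>F s in at_bot. ereal e \<le> ereal (\<phi> s)"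
      unfolding eventually_at_bot_linorder by (intro exI[of _ T]) (metis ereal_less_eq(3) linear)
    from Liminf_bounded[OF this] show False using liminf \<open>e > 0\<close> by simp
  qed
  obtain z where z: "0 \<le> 1 * z" "z \<in> chi_dom K" "chi1 K f0 g0 h z c \<le> 0"
  proof (rule exponent_of_descent[of 1 "\<phi> 0"])
    show "\<exists>s b. 0 \<le> 1 * (s - b) \<and> \<phi> 0 \<le> \<phi> s \<and> \<phi> b \<le> e" if e: "e > 0" for e
    proof -
      obtain b where "b \<le> 0" "\<phi> b \<le> e" using small[OF e] by blast
      hence "0 \<le> 1 * (0 - b) \<and> \<phi> 0 \<le> \<phi> 0 \<and> \<phi> b \<le> e" by simp
      thus ?thesis by blast
    qed
  qed (use pos in auto)
  thus "\<exists>z>0. z \<in> chi_dom K \<and> chi1 K f0 g0 h z c \<le> 0"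
    using chi1_nonpos_imp_nonzero[OF K fg z(3)] by (intro exI[of _ z]) auto
  show "(\<phi> \<longlongrightarrow> 0) at_bot"
  proof (rule ccontr)
    assume "\<not> (\<phi> \<longlongrightarrow> 0) at_bot"
    then obtain \<delta> where \<delta>: "\<delta> > 0" "\<not> (\<forall>\<^sub>F s in at_bot. dist (\<phi> s) 0 < \<delta>)"
      by (auto simp: tendsto_iff)
    have large: "\<exists>s\<le>T. \<delta> \<le> \<phi> s" for T
      using \<delta>(2) pos by (auto simp: eventually_at_bot_linorder not_less abs_of_pos)
    obtain y where y: "0 \<le> - 1 * y" "y \<in> chi_dom K" "chi1 K f0 g0 h y c \<le> 0"
    proof (rule exponent_of_descent[of "- 1" \<delta>])
      fix e :: real assume "e > 0"
      then obtain b where b: "\<phi> b \<le> e" using small by blast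
      obtain s where "s \<le> b" "\<delta> \<le> \<phi> s" using large by blast
      with b have "0 \<le> - 1 * (s - b) \<and> \<delta> \<le> \<phi> s \<and> \<phi> b \<le> e" by simp
      thus "\<exists>s b. 0 \<le> - 1 * (s - b) \<and> \<delta> \<le> \<phi> s \<and> \<phi> b \<le> e" by blast
    qed (use \<delta> in auto)
    show False
      by (rule chi1_nonpos_same_sign[OF K fg g0_pos z(2,3) y(2,3)]) (use z y in auto)
  qed
qed

section \<open>Reflection of space: exchanging the two ends\<close>

lemma lborel_integral_reflect:
  fixes F :: "real \<Rightarrow> real"
  shows "(LINT s|lborel. F (- s)) = (LINT s|lborel. F s)"
  using lborel_integral_real_affine[of "-1" F 0] by simp

lemma lborel_integrable_reflect:
  fixes F :: "real \<Rightarrow> real"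
  shows "integrable lborel (\<lambda>s. F (- s)) \<longleftrightarrow> integrable lborel F"
  using lborel_integrable_real_affine_iff[of "-1" F 0] by simp

lemma conv_kernel_reflect: "conv_kernel K \<Longrightarrow> conv_kernel (\<lambda>s. K (- s))"
  by (simp add: conv_kernel_def lborel_integral_reflect lborel_integrable_reflect)

lemma chi_dom_reflect: "z \<in> chi_dom (\<lambda>s. K (- s)) \<longleftrightarrow> - z \<in> chi_dom K"
  using lborel_integrable_reflect[of "\<lambda>s. K s * exp (z * s)"] by (simp add: chi_dom_def)

lemma chi1_reflect: "chi1 (\<lambda>s. K (- s)) f0 g0 h z c = chi1 K f0 g0 h (- z) (- c)"
  using lborel_integral_reflect[of "\<lambda>s. K s * exp (z * s)"] by (simp add: chi1_def)

lemma Sup_ereal_reflect: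
  assumes "\<And>c. Q c \<longleftrightarrow> P (- c)"
  shows "Sup {ereal c | c. Q c} = - Inf {ereal c | c. P c}"
proof -
  have "{ereal c | c. Q c} = uminus ` {ereal c | c. P c}"
  proof (intro set_eqI iffI)
    fix x assume "x \<in> {ereal c | c. Q c}"
    then obtain c where "x = - ereal (- c)" "P (- c)" using assms by auto
    thus "x \<in> uminus ` {ereal c | c. P c}" by blast
  next
    fix x assume "x \<in> uminus ` {ereal c | c. P c}"
    then obtain c where "x = ereal (- c)" "Q (- c)" using assms by auto
    thus "x \<in> {ereal c | c. Q c}" by blast
  qed
  thus ?thesis by (simp only: ereal_Sup_uminus_image_eq)
qed

text \<open>Reversing the kernel changes the signs of both \<open>z\<close> and \<open>c\<close>.
  The conventions for empty sets of speeds correspond as well.\<close>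

lemma cstar_minus_eq_reflect: "cstar_minus K f0 g0 h = - cstar_plus (\<lambda>s. K (- s)) f0 g0 h"
  unfolding cstar_minus_def cstar_plus_def
proof (rule Sup_ereal_reflect)
  fix c
  \<comment> \<open>The double negation gives the speed the form that \<open>chi1_reflect\<close>
    produces.\<close>
  have "(\<exists>z<0. z \<in> chi_dom K \<and> chi1 K f0 g0 h z c = 0) \<longleftrightarrow>
      (\<exists>z<0. z \<in> chi_dom K \<and> chi1 K f0 g0 h z (- (- c)) = 0)" by simp
  also have "\<dots> \<longleftrightarrow> (\<exists>z>0. - z \<in> chi_dom K \<and> chi1 K f0 g0 h (- z) (- (- c)) = 0)"
  proof
    assume "\<exists>z<0. z \<in> chi_dom K \<and> chi1 K f0 g0 h z (- (- c)) = 0"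
    then obtain z where "z < 0" "z \<in> chi_dom K" "chi1 K f0 g0 h z (- (- c)) = 0" by blast
    thus "\<exists>z>0. - z \<in> chi_dom K \<and> chi1 K f0 g0 h (- z) (- (- c)) = 0"
      by (intro exI[of _ "- z"]) simp
  next
    assume "\<exists>z>0. - z \<in> chi_dom K \<and> chi1 K f0 g0 h (- z) (- (- c)) = 0"
    then obtain z where "z > 0" "- z \<in> chi_dom K" "chi1 K f0 g0 h (- z) (- (- c)) = 0" by blast
    thus "\<exists>z<0. z \<in> chi_dom K \<and> chi1 K f0 g0 h z (- (- c)) = 0"
      by (intro exI[of _ "- z"]) simp
  qed
  finally show "(\<exists>z<0. z \<in> chi_dom K \<and> chi1 K f0 g0 h z c = 0) \<longleftrightarrow>
      (\<exists>z>0. z \<in> chi_dom (\<lambda>s. K (- s)) \<and> chi1 (\<lambda>s. K (- s)) f0 g0 h z (- c) = 0)"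
    by (simp only: chi_dom_reflect chi1_reflect)
qed

lemma pos_bdd_solution_reflect:
  assumes "pos_bdd_solution K f g h c \<phi>"
  shows "pos_bdd_solution (\<lambda>s. K (- s)) f g h (- c) (\<lambda>t. \<phi> (- t))"
proof -
  obtain \<phi>1 \<phi>2 where d: "\<And>t. (\<phi> has_real_derivative \<phi>1 t) (at t)" "\<And>t. (\<phi>1 has_real_derivative \<phi>2 t) (at t)"
      and cont: "continuous_on UNIV \<phi>2"
      and eq: "\<And>t. \<phi>2 t - c * \<phi>1 t - f (\<phi> t) + (LINT s|lborel. K s * g (\<phi> (t - s - c * h))) = 0"
      and pos: "\<And>t. \<phi> t > 0" and bdd: "bounded (range \<phi>)"
    using assms unfolding pos_bdd_solution_def tw_solution_def by blast
  have "tw_solution (\<lambda>s. K (- s)) f g h (- c) (\<lambda>t. \<phi> (- t))"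
    unfolding tw_solution_def
  proof (rule exI[of _ "\<lambda>t. - \<phi>1 (- t)"], rule exI[of _ "\<lambda>t. \<phi>2 (- t)"], intro conjI allI)
    fix t
    show "((\<lambda>t. \<phi> (- t)) has_real_derivative - \<phi>1 (- t)) (at t)"
      using d(1)[of "- t"] DERIV_mirror[of \<phi> "\<phi>1 (- t)" t] by simp
    show "((\<lambda>t. - \<phi>1 (- t)) has_real_derivative \<phi>2 (- t)) (at t)"
      using DERIV_minus[of "\<lambda>t. \<phi>1 (- t)" "- \<phi>2 (- t)" t] d(2)[of "- t"] DERIV_mirror[of \<phi>1 "\<phi>2 (- t)" t]
      by simp
    have "(LINT s|lborel. K (- s) * g (\<phi> (- (t - s - - c * h)))) = (LINT s|lborel. K s * g (\<phi> (- t - s - c * h)))"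
      using lborel_integral_reflect[of "\<lambda>s. K s * g (\<phi> (- t - s - c * h))"] by (simp add: algebra_simps)
    thus "\<phi>2 (- t) - - c * - \<phi>1 (- t) - f (\<phi> (- t))
        + (LINT s|lborel. K (- s) * g (\<phi> (- (t - s - - c * h)))) = 0"
      using eq[of "- t"] by simp
  next
    show "continuous_on UNIV (\<lambda>t. \<phi>2 (- t))"
      by (rule continuous_on_compose2[OF cont]) (auto intro!: continuous_intros)
  qed
  moreover have "bounded (range (\<lambda>t. \<phi> (- t)))"
    by (rule bounded_subset[OF bdd]) auto
  ultimately show ?thesis using pos by (simp add: pos_bdd_solution_def)
qed

section \<open>Speed bounds and exclusion of pulses and semi-wavefronts\<close>

text \<open>The positive exponent found at minus infinity gives the upper bound by \<open>c\<close>,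
  which excludes \<open>\<infinity>\<close>; the bound from below depends on the kernel and the
  parameters only.\<close>

lemma critical_speed_bound:
  assumes K: "conv_kernel K" and F: "condF f g f0 g0" and "0 \<le> h"
    and sol: "pos_bdd_solution K f g h c \<phi>" and liminf: "Liminf at_bot (\<lambda>s. ereal (\<phi> s)) = 0"
  shows "cstar_plus K f0 g0 h \<noteq> \<infinity>" "cstar_plus K f0 g0 h \<noteq> - \<infinity>" "cstar_plus K f0 g0 h \<le> ereal c"
proof -
  have fg: "0 < f0" "f0 < g0" using F by (auto simp: condF_def)
  obtain z where z: "z > 0" "z \<in> chi_dom K" "chi1 K f0 g0 h z c \<le> 0"
    using vanishing_at_bot(2)[OF K F sol liminf] by blast
  show *: "cstar_plus K f0 g0 h \<le> ereal c"
    by (rule cstar_plus_le[OF K \<open>0 \<le> h\<close> _ z]) (use fg in simp)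
  thus "cstar_plus K f0 g0 h \<noteq> \<infinity>" by auto
  show "cstar_plus K f0 g0 h \<noteq> - \<infinity>"
    by (rule cstar_plus_bounded_below[OF K \<open>0 \<le> h\<close> fg])
qed

lemma Liminf_at_top_reflect:
  fixes F :: "real \<Rightarrow> ereal"
  shows "Liminf at_bot (\<lambda>s. F (- s)) = Liminf at_top F"
proof -
  have "C \<le> Liminf at_bot (\<lambda>s. F (- s)) \<longleftrightarrow> C \<le> Liminf at_top F" for C
    unfolding le_Liminf_iff at_top_mirror eventually_filtermap by simp
  thus ?thesis by (meson order_antisym order_refl)
qed

theorem theorem5p3:
  fixes K f g :: "real \<Rightarrow> real" and h c f0 g0 :: real
  assumes "h \<ge> 0" and "conv_kernel K" and "condF f g f0 g0"
  shows "(\<forall>\<phi>. pos_bdd_solution K f g h c \<phi> \<and> Liminf at_bot (\<lambda>s. ereal (\<phi> s)) = 0 \<longrightarrow>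
            (\<phi> \<longlongrightarrow> 0) at_bot \<and> cstar_plus K f0 g0 h \<noteq> \<infinity> \<and> cstar_plus K f0 g0 h \<noteq> - \<infinity> \<and>
            cstar_plus K f0 g0 h \<le> ereal c)
       \<and> (\<forall>\<phi>. pos_bdd_solution K f g h c \<phi> \<and> Liminf at_top (\<lambda>s. ereal (\<phi> s)) = 0 \<longrightarrow>
            (\<phi> \<longlongrightarrow> 0) at_top \<and> cstar_minus K f0 g0 h \<noteq> \<infinity> \<and> cstar_minus K f0 g0 h \<noteq> - \<infinity> \<and>
            ereal c \<le> cstar_minus K f0 g0 h)
       \<and> \<not> (\<exists>\<phi>. pos_bdd_solution K f g h c \<phi> \<and> (\<phi> \<longlongrightarrow> 0) at_bot \<and> (\<phi> \<longlongrightarrow> 0) at_top)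
       \<and> (cstar_minus K f0 g0 h < ereal c \<and> ereal c < cstar_plus K f0 g0 h \<longrightarrow>
            \<not> (\<exists>\<phi>. semi_wavefront K f g h c \<phi>))"
proof -
  note K = \<open>conv_kernel K\<close> and F = \<open>condF f g f0 g0\<close> and h = \<open>h \<ge> 0\<close>
  have fg: "f0 < g0" "0 < g0" using F by (auto simp: condF_def)
  let ?K = "\<lambda>s. K (- s)"
  have bot: "(\<phi> \<longlongrightarrow> 0) at_bot \<and> cstar_plus K f0 g0 h \<noteq> \<infinity> \<and> cstar_plus K f0 g0 h \<noteq> - \<infinity> \<and>
      cstar_plus K f0 g0 h \<le> ereal c"
    if "pos_bdd_solution K f g h c \<phi>" "Liminf at_bot (\<lambda>s. ereal (\<phi> s)) = 0" for \<phi>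
    using vanishing_at_bot(1)[OF K F that] critical_speed_bound[OF K F h that] by blast
  \<comment> \<open>The results at minus infinity are applied to the mirrored solution with speed
    \<open>- c\<close>. The negative exponent is kept for the exclusion of pulses.\<close>
  have top: "(\<phi> \<longlongrightarrow> 0) at_top \<and> cstar_minus K f0 g0 h \<noteq> \<infinity> \<and> cstar_minus K f0 g0 h \<noteq> - \<infinity> \<and>
      ereal c \<le> cstar_minus K f0 g0 h \<and> (\<exists>y<0. y \<in> chi_dom K \<and> chi1 K f0 g0 h y c \<le> 0)"
    if sol: "pos_bdd_solution K f g h c \<phi>" and lim: "Liminf at_top (\<lambda>s. ereal (\<phi> s)) = 0" for \<phi>
  proof -
    note refl = conv_kernel_reflect[OF K] F
    have sol': "pos_bdd_solution ?K f g h (- c) (\<lambda>t. \<phi> (- t))" by (rule pos_bdd_solution_reflect[OF sol])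
    have lim': "Liminf at_bot (\<lambda>s. ereal (\<phi> (- s))) = 0" using lim Liminf_at_top_reflect[of "\<lambda>s. ereal (\<phi> s)"] by simp
    have "(\<phi> \<longlongrightarrow> 0) at_top"
      using vanishing_at_bot(1)[OF refl sol' lim'] by (simp add: filterlim_at_top_mirror)
    moreover obtain z where "z > 0" "z \<in> chi_dom ?K" "chi1 ?K f0 g0 h z (- c) \<le> 0"
      using vanishing_at_bot(2)[OF refl sol' lim'] by blast
    hence "\<exists>y<0. y \<in> chi_dom K \<and> chi1 K f0 g0 h y c \<le> 0"
      by (intro exI[of _ "- z"]) (auto simp: chi_dom_reflect chi1_reflect)
    moreover note critical_speed_bound[OF refl h sol' lim']
    ultimately show ?thesis
      unfolding cstar_minus_eq_reflect by (cases "cstar_plus ?K f0 g0 h") auto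
  qed
  have lim_bot: "Liminf at_bot (\<lambda>s. ereal (\<phi> s)) = 0" if "(\<phi> \<longlongrightarrow> 0) at_bot" for \<phi> :: "real \<Rightarrow> real"
    using that by (intro lim_imp_Liminf) (auto simp: zero_ereal_def)
  have lim_top: "Liminf at_top (\<lambda>s. ereal (\<phi> s)) = 0" if "(\<phi> \<longlongrightarrow> 0) at_top" for \<phi> :: "real \<Rightarrow> real"
    using that by (intro lim_imp_Liminf) (auto simp: zero_ereal_def)
  \<comment> \<open>A pulse would have exponents of both signs for one speed, so it is excluded for
    every \<open>c\<close>.\<close>
  have "False" if sol: "pos_bdd_solution K f g h c \<phi>" and lims: "(\<phi> \<longlongrightarrow> 0) at_bot" "(\<phi> \<longlongrightarrow> 0) at_top" for \<phi>
  proof -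
    obtain x where x: "x > 0" "x \<in> chi_dom K" "chi1 K f0 g0 h x c \<le> 0"
      using vanishing_at_bot(2)[OF K F sol lim_bot[OF lims(1)]] by blast
    obtain y where y: "y < 0" "y \<in> chi_dom K" "chi1 K f0 g0 h y c \<le> 0"
      using top[OF sol lim_top[OF lims(2)]] by blast
    show False
      by (rule chi1_nonpos_same_sign[OF K fg x(2,3) y(2,3)]) (use x(1) y(1) in auto)
  qed
  moreover have "\<not> semi_wavefront K f g h c \<phi>"
    if "cstar_minus K f0 g0 h < ereal c" "ereal c < cstar_plus K f0 g0 h" for \<phi>
    using bot[OF _ lim_bot, of \<phi>] top[OF _ lim_top, of \<phi>] leD that
    unfolding semi_wavefront_def by blast
  ultimately show ?thesis using bot top by blast
qed

end
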